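(* Let $(U,\Lambda,D,V)$ be an analytic problem with an MRD discretization of $V$ (well-posedness is not assumed), and let $v^*\in V$ be given data, not necessarily of the form $Du^*$ with $u^*\in U$. Then for every finite-dimensional trial space $U_M\subseteq U$ there is an admissible restriction $(R_N,V_N)$ with $$\|u_M\|_D\le 2\,\|R_ND(u_M)\|_{V_N}\quad\text{for all }u_M\in U_M,$$ such that the following holds: if $C_A\ge 1$, if $u_M^*\in U_M$ is a minimizer of $\|v^*-Du_M\|_V$ over all $u_M\in U_M$, and if $\tilde u_M\in U_M$ satisfies $$\|R_Nv^*-R_ND\tilde u_M\|_{V_N}\le C_A\,\|R_Nv^*-R_NDu_M^*\|_{V_N},$$ then $$\|v^*-D\tilde u_M\|_V\le (2C_A+3)\min_{u_M\in U_M}\|v^*-Du_M\|_V .$$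
   Context: Analytic problem: a real normed linear space $U$ (objects), a set $\Lambda$ of linear functionals on $U$, the data map $D:U\to\mathbb{R}^\Lambda$, $D(u)=\{\lambda(u)\}_{\lambda\in\Lambda}$, and a normed data space $V\subseteq\mathbb{R}^\Lambda$ containing $D(U)$ whose norm satisfies $\|Du\|_V=\sup_{\lambda\in\Lambda}|\lambda(u)|<\infty$ for all $u\in U$. Put $\|u\|_D:=\|Du\|_V$ (a seminorm on $U$). MRD (monotone refinable dense) discretization of a normed data space $V$: a (nonempty) set of pairs $(R_N,V_N)$, called admissible restrictions, together with a relation $\preceq$ (refinement) on them, such that (1) each $V_N$ is a finite-dimensional real normed space with norm $\|\cdot\|_{V_N}$; (2) each $R_N:V\to V_N$ is linear; (3) (monotonicity) $(R_M,V_M)\preceq(R_N,V_N)$ implies $\|R_Mv\|_{V_M}\le\|R_Nv\|_{V_N}$ for all $v\in V$; (4) (refinement) for any two admissible restrictions $(R_M,V_M)$, $(R_N,V_N)$ there is an admissible restriction $(R_P,V_P)$ with $(R_M,V_M)\preceq(R_P,V_P)$ and $(R_N,V_N)\preceq(R_P,V_P)$; (5) (density) $\|v\|_V=\sup\|R_Nv\|_{V_N}$ for all $v\in V$, the supremum being over all admissible restrictions. *)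

theory Defs
  imports "HOL-Analysis.Analysis" "HOL-Library.Function_Algebras"
begin

instantiation "fun" :: (type, real_vector) real_vector
begin

definition scaleR_fun :: "real \<Rightarrow> ('a \<Rightarrow> 'b) \<Rightarrow> 'a \<Rightarrow> 'b"
  where "scaleR_fun c f = (\<lambda>x. c *\<^sub>R f x)"

instance
  by standard
    (simp_all add: scaleR_fun_def fun_eq_iff scaleR_add_right scaleR_add_left)

end

definition finite_dim_subspace :: "'a::real_vector set \<Rightarrow> bool"
  where "finite_dim_subspace W \<longleftrightarrow> (\<exists>B. finite B \<and> W = span B)"

definition norm_on :: "'a::real_vector set \<Rightarrow> ('a \<Rightarrow> real) \<Rightarrow> bool"
  where "norm_on W nrm \<longleftrightarrow>
    (\<forall>x\<in>W. 0 \<le> nrm x) \<and>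
    (\<forall>x\<in>W. nrm x = 0 \<longleftrightarrow> x = 0) \<and>
    (\<forall>c. \<forall>x\<in>W. nrm (c *\<^sub>R x) = \<bar>c\<bar> * nrm x) \<and>
    (\<forall>x\<in>W. \<forall>y\<in>W. nrm (x + y) \<le> nrm x + nrm y)"

definition linear_map_on ::
    "'a::real_vector set \<Rightarrow> 'b::real_vector set \<Rightarrow> ('a \<Rightarrow> 'b) \<Rightarrow> bool"
  where "linear_map_on V W f \<longleftrightarrow>
    f ` V \<subseteq> W \<and>
    (\<forall>x\<in>V. \<forall>y\<in>V. f (x + y) = f x + f y) \<and>
    (\<forall>c. \<forall>x\<in>V. f (c *\<^sub>R x) = c *\<^sub>R f x)"

text \<open>
  The space of real functions on a set \<open>\<Lambda>\<close> of functionals is encoded by the total functions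
  that vanish outside \<open>\<Lambda>\<close>, so that its vector space operations are the pointwise ones.
\<close>

type_synonym 'u data = "('u \<Rightarrow> real) \<Rightarrow> real"

definition data_functions :: "('u \<Rightarrow> real) set \<Rightarrow> 'u data set"
  where "data_functions \<Lambda> = {v. \<forall>l. l \<notin> \<Lambda> \<longrightarrow> v l = 0}"

definition data_map :: "('u \<Rightarrow> real) set \<Rightarrow> 'u \<Rightarrow> 'u data"
  where "data_map \<Lambda> u = (\<lambda>l. if l \<in> \<Lambda> then l u else 0)"

text \<open>
  Suprema of nonnegative quantities are taken in \<open>[0, \<infinity>]\<close>. Equating such a supremum with the
  image of a real number also says that it is finite, and the supremum over the empty set is 0.
\<close>

locale analytic_problem =
  fixes \<Lambda> :: "('u::real_normed_vector \<Rightarrow> real) set"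
    and V :: "'u data set"
    and normV :: "'u data \<Rightarrow> real"
  assumes functionals_linear: "\<And>l. l \<in> \<Lambda> \<Longrightarrow> linear l"
    and V_data: "V \<subseteq> data_functions \<Lambda>"
    and V_subspace: "subspace V"
    and V_norm: "norm_on V normV"
    and data_map_in_V: "range (data_map \<Lambda>) \<subseteq> V"
    and normV_data_map:
      "\<And>u. ennreal (normV (data_map \<Lambda> u)) = (SUP l\<in>\<Lambda>. ennreal \<bar>l u\<bar>)"

definition data_seminorm ::
    "('u \<Rightarrow> real) set \<Rightarrow> ('u data \<Rightarrow> real) \<Rightarrow> 'u \<Rightarrow> real"
  where "data_seminorm \<Lambda> normV u = normV (data_map \<Lambda> u)"

text \<open>
  A restriction is a map together with a normed target space, given by its carrier and its norm.
  The target spaces of different restrictions are subspaces of one ambient vector space \<open>'w\<close>,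
  which carries no norm itself. This is no loss of generality: any family of vector spaces
  embeds into its direct sum.
\<close>

record ('v, 'w) restriction =
  res_map :: "'v \<Rightarrow> 'w"
  res_space :: "'w set"
  res_norm :: "'w \<Rightarrow> real"

locale MRD_discretization =
  fixes V :: "'v::real_vector set"
    and normV :: "'v \<Rightarrow> real"
    and adm :: "('v, 'w::real_vector) restriction set"
    and refines :: "('v, 'w) restriction \<Rightarrow> ('v, 'w) restriction \<Rightarrow> bool"  (infix \<open>\<preceq>\<close> 50)
  assumes adm_nonempty: "adm \<noteq> {}"
    and res_space_finite_dim: "\<And>r. r \<in> adm \<Longrightarrow> finite_dim_subspace (res_space r)"
    and res_space_norm: "\<And>r. r \<in> adm \<Longrightarrow> norm_on (res_space r) (res_norm r)"
    and res_map_linear: "\<And>r. r \<in> adm \<Longrightarrow> linear_map_on V (res_space r) (res_map r)"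
    and monotonicity: "\<And>r s v. r \<in> adm \<Longrightarrow> s \<in> adm \<Longrightarrow> r \<preceq> s \<Longrightarrow> v \<in> V \<Longrightarrow>
      res_norm r (res_map r v) \<le> res_norm s (res_map s v)"
    and refinement: "\<And>r s. r \<in> adm \<Longrightarrow> s \<in> adm \<Longrightarrow> \<exists>p\<in>adm. r \<preceq> p \<and> s \<preceq> p"
    and density: "\<And>v. v \<in> V \<Longrightarrow>
      ennreal (normV v) = (SUP r\<in>adm. ennreal (res_norm r (res_map r v)))"

end

theory Submission
  imports Defs
begin

text \<open>
  A restriction \<open>r\<close> induces the seminorm \<open>v \<mapsto> res_norm r (res_map r v)\<close> on \<open>V\<close>. These seminorms
  form a directed family whose pointwise supremum is the norm of \<open>V\<close>. On a compact set that avoids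
  \<open>0\<close>, such as a sphere of a finite-dimensional subspace, the convergence is uniform by Dini's
  argument: near each point one seminorm already exceeds a fixed fraction \<open>\<theta> < 1\<close> of the norm,
  finitely many of these neighbourhoods suffice, and a common refinement of the finitely many
  restrictions works on the whole sphere, hence by homogeneity on the subspace
  (\<open>directed_seminorms_dominate\<close>). With \<open>\<theta> = 1/2\<close> and the subspace \<open>D(U\<^sub>M)\<close> this yields the
  stability inequality.

  The error bound (\<open>quasi_optimal_error_bound\<close>) compares the computed \<open>u_tilde\<close> with the
  minimizer \<open>u_star\<close>, whose error is \<open>E\<close>. Stability bounds \<open>\<parallel>D(u_star - u_tilde)\<parallel>\<close> by twice its restriction,
  which the quasi-optimality of \<open>u_tilde\<close> bounds by \<open>(C\<^sub>A + 1) E\<close>, as restrictions do not increase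
  the norm. The triangle inequality gives \<open>E + 2 (C\<^sub>A + 1) E = (2 C\<^sub>A + 3) E\<close>. The minimizer takes
  the place of an exact solution.
\<close>

section \<open>Seminorms on a subspace\<close>

definition seminorm_on :: "'a::real_vector set \<Rightarrow> ('a \<Rightarrow> real) \<Rightarrow> bool"
  where "seminorm_on V p \<longleftrightarrow>
    (\<forall>x\<in>V. 0 \<le> p x) \<and>
    (\<forall>c. \<forall>x\<in>V. p (c *\<^sub>R x) = \<bar>c\<bar> * p x) \<and>
    (\<forall>x\<in>V. \<forall>y\<in>V. p (x + y) \<le> p x + p y)"

lemma norm_on_imp_seminorm_on: "norm_on V p \<Longrightarrow> seminorm_on V p"
  by (auto simp: norm_on_def seminorm_on_def)

lemma seminorm_on_scaleR: "seminorm_on V p \<Longrightarrow> x \<in> V \<Longrightarrow> p (c *\<^sub>R x) = \<bar>c\<bar> * p x"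
  and seminorm_on_triangle: "seminorm_on V p \<Longrightarrow> x \<in> V \<Longrightarrow> y \<in> V \<Longrightarrow> p (x + y) \<le> p x + p y"
  by (auto simp: seminorm_on_def)

lemma seminorm_on_zero: "seminorm_on V p \<Longrightarrow> subspace V \<Longrightarrow> p 0 = 0"
  using seminorm_on_scaleR[of V p 0 0] by (simp add: subspace_0)

lemma seminorm_on_minus_commute:
  assumes "seminorm_on V p" "subspace V" "x \<in> V" "y \<in> V"
  shows "p (x - y) = p (y - x)"
  using seminorm_on_scaleR[OF assms(1), of "x - y" "-1"] assms by (simp add: subspace_diff)

lemma seminorm_on_triangle_sub:
  assumes "seminorm_on V p" "subspace V" "x \<in> V" "y \<in> V"
  shows "p x \<le> p y + p (x - y)"
  using seminorm_on_triangle[OF assms(1), of y "x - y"] assms by (simp add: subspace_diff)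

lemma seminorm_on_diff_abs:
  assumes "seminorm_on V p" "subspace V" "x \<in> V" "y \<in> V"
  shows "\<bar>p x - p y\<bar> \<le> p (x - y)"
  using seminorm_on_triangle_sub[OF assms] seminorm_on_triangle_sub[OF assms(1,2,4,3)]
    seminorm_on_minus_commute[OF assms] by linarith

lemma seminorm_on_sum_le:
  assumes p: "seminorm_on V p" and V: "subspace V" and B: "B \<subseteq> V"
  shows "p (\<Sum>b\<in>B. c b *\<^sub>R b) \<le> (\<Sum>b\<in>B. \<bar>c b\<bar> * p b)"
proof -
  have "finite F \<Longrightarrow> F \<subseteq> V \<Longrightarrow> p (\<Sum>b\<in>F. c b *\<^sub>R b) \<le> (\<Sum>b\<in>F. \<bar>c b\<bar> * p b)" for F
  proof (induction F rule: finite_induct)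
    case empty
    then show ?case by (simp add: seminorm_on_zero[OF p V])
  next
    case (insert a F)
    have "(\<Sum>b\<in>F. c b *\<^sub>R b) \<in> V"
      using insert.prems by (intro subspace_sum[OF V] subspace_scale[OF V]) auto
    moreover have "c a *\<^sub>R a \<in> V"
      using insert.prems by (auto intro: subspace_scale[OF V])
    ultimately have "p (c a *\<^sub>R a + (\<Sum>b\<in>F. c b *\<^sub>R b)) \<le> p (c a *\<^sub>R a) + p (\<Sum>b\<in>F. c b *\<^sub>R b)"
      by (intro seminorm_on_triangle[OF p])
    then show ?case
      using insert seminorm_on_scaleR[OF p, of a "c a"] by simp
  qed
  then show ?thesis
    using B by (cases "finite B") (simp_all add: seminorm_on_zero[OF p V])
qed

text \<open>
  Coordinate vectors are functions with the product topology, because cubes are compact there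
  whatever the size of \<open>B\<close>. The seminorm is Lipschitz in each coordinate that enters the sum, with
  constant \<open>p b\<close>.
\<close>

lemma continuous_on_seminorm_coordinates:
  fixes B :: "'v::real_vector set"
  assumes p: "seminorm_on V p" and V: "subspace V" and B: "B \<subseteq> V"
  shows "continuous_on UNIV (\<lambda>c::'v \<Rightarrow> real. p (\<Sum>b\<in>B. c b *\<^sub>R b))"
proof -
  have inV: "(\<Sum>b\<in>B. c b *\<^sub>R b) \<in> V" for c
    using B by (intro subspace_sum[OF V] subspace_scale[OF V]) auto
  have lipschitz: "\<bar>p (\<Sum>b\<in>B. c b *\<^sub>R b) - p (\<Sum>b\<in>B. d b *\<^sub>R b)\<bar> \<le> (\<Sum>b\<in>B. \<bar>c b - d b\<bar> * p b)"
    for c d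
    using seminorm_on_diff_abs[OF p V inV[of c] inV[of d]]
      seminorm_on_sum_le[OF p V B, of "\<lambda>b. c b - d b"]
    by (simp add: scaleR_left_diff_distrib sum_subtractf)
  have "((\<lambda>c. p (\<Sum>b\<in>B. c b *\<^sub>R b)) \<longlongrightarrow> p (\<Sum>b\<in>B. d b *\<^sub>R b)) (at d)" for d :: "'v \<Rightarrow> real"
  proof (rule LIM_zero_cancel, rule Lim_null_comparison)
    show "\<forall>\<^sub>F c in at d. norm (p (\<Sum>b\<in>B. c b *\<^sub>R b) - p (\<Sum>b\<in>B. d b *\<^sub>R b))
        \<le> (\<Sum>b\<in>B. \<bar>c b - d b\<bar> * p b)"
      using lipschitz by simp
    have "continuous_on UNIV (\<lambda>c. \<Sum>b\<in>B. \<bar>c b - d b\<bar> * p b)"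
      by (intro continuous_intros continuous_on_product_coordinates)
    then have "((\<lambda>c. \<Sum>b\<in>B. \<bar>c b - d b\<bar> * p b) \<longlongrightarrow> (\<Sum>b\<in>B. \<bar>d b - d b\<bar> * p b)) (at d)"
      by (simp only: continuous_on_def) blast
    then show "((\<lambda>c. \<Sum>b\<in>B. \<bar>c b - d b\<bar> * p b) \<longlongrightarrow> 0) (at d)"
      by simp
  qed
  then show ?thesis
    by (simp add: continuous_on_def)
qed

section \<open>Uniform domination by directed families of seminorms\<close>

lemma compact_PiE_UNIV:
  fixes S :: "'a \<Rightarrow> 'b::topological_space set"
  assumes "\<And>x. compact (S x)"
  shows "compact (PiE UNIV S)"
proof -
  have "compactin (product_topology (\<lambda>_. euclidean) UNIV) (PiE UNIV S)"
    using assms by (simp add: compactin_PiE)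
  then show ?thesis
    by (simp add: euclidean_product_topology)
qed

lemma directed_family_finite_upper_bound:
  fixes p :: "'i \<Rightarrow> 'v \<Rightarrow> real"
  assumes "I \<noteq> {}"
    and directed: "\<And>i j. i \<in> I \<Longrightarrow> j \<in> I \<Longrightarrow> \<exists>k\<in>I. \<forall>v\<in>V. p i v \<le> p k v \<and> p j v \<le> p k v"
    and "finite F" "F \<subseteq> I"
  shows "\<exists>k\<in>I. \<forall>i\<in>F. \<forall>v\<in>V. p i v \<le> p k v"
  using assms(3,4)
proof (induction F rule: finite_induct)
  case empty
  then show ?case using \<open>I \<noteq> {}\<close> by auto
next
  case (insert j F)
  then obtain k where k: "k \<in> I" "\<forall>i\<in>F. \<forall>v\<in>V. p i v \<le> p k v" by auto
  obtain m where "m \<in> I" "\<forall>v\<in>V. p k v \<le> p m v \<and> p j v \<le> p m v"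
    using directed[of k j] k insert.prems by auto
  with k show ?case by (intro bexI[of _ m]) (auto intro: order_trans)
qed

text \<open>
  The sphere is replaced by the linear combinations of basis vectors having one coefficient \<open>1\<close> and
  all others in \<open>[-1, 1]\<close>. Every nonzero vector becomes such a combination after division by its
  coefficient of largest modulus. Independence of \<open>B\<close> keeps these combinations away from \<open>0\<close>.
\<close>

lemma directed_seminorms_dominate:
  fixes V B :: "'v::real_vector set" and p :: "'i \<Rightarrow> 'v \<Rightarrow> real"
  assumes V: "subspace V" and n: "seminorm_on V n"
    and p: "\<And>i. i \<in> I \<Longrightarrow> seminorm_on V (p i)"
    and nonempty: "I \<noteq> {}"
    and directed: "\<And>i j. i \<in> I \<Longrightarrow> j \<in> I \<Longrightarrow> \<exists>k\<in>I. \<forall>v\<in>V. p i v \<le> p k v \<and> p j v \<le> p k v"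
    and exceeds: "\<And>v. v \<in> V \<Longrightarrow> v \<noteq> 0 \<Longrightarrow> \<exists>i\<in>I. \<theta> * n v < p i v"
    and B: "finite B" "independent B" "B \<subseteq> V"
  shows "\<exists>i\<in>I. \<forall>w\<in>span B. \<theta> * n w \<le> p i w"
proof -
  define L where "L c = (\<Sum>b\<in>B. c b *\<^sub>R b)" for c :: "'v \<Rightarrow> real"
  \<comment> \<open>Indices outside \<open>B\<close> get the factor \<open>[-1, 1]\<close> as well, since compactness of the product needs
    compact factors.\<close>
  define K where
    "K = (\<Union>b\<in>B. PiE UNIV (\<lambda>x. if x = b then {1} else {-1..1::real}))"
  define A where "A i = {c. \<theta> * n (L c) < p i (L c)}" for i
  have L_in_V: "L c \<in> V" for c
    unfolding L_def using B by (intro subspace_sum[OF V] subspace_scale[OF V]) auto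
  have "compact K"
    unfolding K_def by (intro compact_UN compact_PiE_UNIV B) auto
  moreover have "open (A i)" if "i \<in> I" for i
    unfolding A_def L_def
    by (intro open_Collect_less continuous_on_mult continuous_on_const
        continuous_on_seminorm_coordinates[OF n V] continuous_on_seminorm_coordinates[OF p V] that B)
  moreover have "K \<subseteq> (\<Union>i\<in>I. A i)"
  proof
    fix c assume "c \<in> K"
    then obtain b where b: "b \<in> B" and c: "c \<in> PiE UNIV (\<lambda>x. if x = b then {1} else {-1..1})"
      unfolding K_def by auto
    have "c b = 1" using PiE_mem[OF c, of b] by simp
    then have "L c \<noteq> 0"
      using independentD[OF B(2,1) order_refl, of c b] b unfolding L_def by auto
    then show "c \<in> (\<Union>i\<in>I. A i)"
      using exceeds[OF L_in_V[of c]] by (auto simp: A_def)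
  qed
  ultimately obtain F where F: "F \<subseteq> I" "finite F" "K \<subseteq> (\<Union>i\<in>F. A i)"
    by (rule compactE_image)
  obtain k where k: "k \<in> I" "\<forall>i\<in>F. \<forall>v\<in>V. p i v \<le> p k v"
    using directed_family_finite_upper_bound[OF nonempty directed F(2,1)] by auto
  have on_K: "\<theta> * n (L c) \<le> p k (L c)" if cK: "c \<in> K" for c
  proof -
    obtain i where "i \<in> F" "\<theta> * n (L c) < p i (L c)"
      using subsetD[OF F(3) cK] by (auto simp: A_def)
    moreover have "p i (L c) \<le> p k (L c)"
      using k(2) \<open>i \<in> F\<close> L_in_V by blast
    ultimately show ?thesis by linarith
  qed
  have "\<theta> * n w \<le> p k w" if w_span: "w \<in> span B" for w
  proof (cases "w = 0")
    case True
    then show ?thesis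
      using seminorm_on_zero[OF n V] seminorm_on_zero[OF p[OF k(1)] V] by simp
  next
    case False
    obtain c where w: "w = L c"
      using w_span span_finite[OF B(1)] by (auto simp: L_def)
    then have "B \<noteq> {}" using False by (auto simp: L_def)
    then obtain b where b: "b \<in> B" and "Max ((\<lambda>x. \<bar>c x\<bar>) ` B) = \<bar>c b\<bar>"
      by (rule obtains_MAX[OF B(1)])
    then have max: "\<bar>c x\<bar> \<le> \<bar>c b\<bar>" if "x \<in> B" for x
      using B(1) that by (metis Max_ge finite_imageI imageI)
    have "c b \<noteq> 0"
    proof
      assume "c b = 0"
      then have "c x = 0" if "x \<in> B" for x using max[OF that] by simp
      then have "L c = 0" by (simp add: L_def)
      then show False using False w by simp
    qed
    define d where "d x = (if x \<in> B then c x / c b else 0)" for x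
    have "\<bar>d x\<bar> \<le> 1" for x
      using max[of x] \<open>c b \<noteq> 0\<close> by (simp add: d_def)
    then have "d \<in> PiE UNIV (\<lambda>x. if x = b then {1} else {-1..1})"
      using b \<open>c b \<noteq> 0\<close> by (auto simp: d_def abs_le_iff minus_le_iff)
    then have "d \<in> K" using b by (auto simp: K_def)
    have "w = c b *\<^sub>R L d"
      using \<open>c b \<noteq> 0\<close> by (simp add: w L_def d_def scaleR_sum_right)
    then have "n w = \<bar>c b\<bar> * n (L d)" "p k w = \<bar>c b\<bar> * p k (L d)"
      using seminorm_on_scaleR[OF n L_in_V[of d]] seminorm_on_scaleR[OF p[OF k(1)] L_in_V[of d]]
      by simp_all
    then show ?thesis
      using mult_left_mono[OF on_K[OF \<open>d \<in> K\<close>], of "\<bar>c b\<bar>"] by (simp add: mult.left_commute)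
  qed
  with k(1) show ?thesis by blast
qed

section \<open>Stability and error bounds for restrictions\<close>

context MRD_discretization
begin

definition restricted_norm :: "('a, 'b) restriction \<Rightarrow> 'a \<Rightarrow> real"
  where "restricted_norm r v = res_norm r (res_map r v)"

lemma res_map_diff:
  assumes V: "subspace V" and r: "r \<in> adm" and "x \<in> V" "y \<in> V"
  shows "res_map r (x - y) = res_map r x - res_map r y"
proof -
  have "res_map r ((x - y) + y) = res_map r (x - y) + res_map r y"
    using res_map_linear[OF r] assms by (simp only: linear_map_on_def subspace_diff)
  then show ?thesis by (simp add: algebra_simps)
qed

lemma restricted_norm_seminorm: "r \<in> adm \<Longrightarrow> seminorm_on V (restricted_norm r)"
  using res_space_norm[of r] res_map_linear[of r]
  by (auto simp: seminorm_on_def norm_on_def linear_map_on_def restricted_norm_def image_subset_iff)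

lemma restricted_norm_le:
  assumes n: "norm_on V normV" and r: "r \<in> adm" and v: "v \<in> V"
  shows "restricted_norm r v \<le> normV v"
proof -
  have "ennreal (restricted_norm r v) \<le> ennreal (normV v)"
    unfolding density[OF v] restricted_norm_def using r by (rule SUP_upper)
  then show ?thesis
    using n v by (simp add: norm_on_def)
qed

lemma restricted_norm_exceeds_fraction:
  assumes n: "norm_on V normV" and v: "v \<in> V" "v \<noteq> 0" and "0 \<le> \<theta>" "\<theta> < 1"
  shows "\<exists>r\<in>adm. \<theta> * normV v < restricted_norm r v"
proof -
  have "0 < normV v"
    using n v by (auto simp: norm_on_def less_le)
  then have "ennreal (\<theta> * normV v) < (SUP r\<in>adm. ennreal (restricted_norm r v))"
    unfolding restricted_norm_def density[OF v(1), symmetric]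
    using assms by (simp add: ennreal_less_iff)
  then obtain r where "r \<in> adm" "ennreal (\<theta> * normV v) < ennreal (restricted_norm r v)"
    by (auto simp: less_SUP_iff)
  moreover have "0 \<le> \<theta> * normV v"
    using assms \<open>0 < normV v\<close> by simp
  ultimately show ?thesis
    by (auto simp: ennreal_less_iff)
qed

theorem stable_restriction_exists:
  assumes V: "subspace V" and n: "norm_on V normV"
    and W: "finite_dim_subspace W" "W \<subseteq> V" and \<theta>: "0 \<le> \<theta>" "\<theta> < 1"
  shows "\<exists>r\<in>adm. \<forall>w\<in>W. \<theta> * normV w \<le> restricted_norm r w"
proof -
  obtain S where S: "finite S" "W = span S"
    using W(1) by (auto simp: finite_dim_subspace_def)
  obtain B where B: "B \<subseteq> S" "independent B" "S \<subseteq> span B"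
    by (rule maximal_independent_subset)
  have "W = span B"
    using S(2) B by (metis span_eq span_superset subset_trans)
  moreover have "finite B" "B \<subseteq> V"
    using B(1) S W(2) span_superset[of S] by (auto intro: finite_subset)
  moreover have "\<exists>t\<in>adm. \<forall>v\<in>V.
      restricted_norm r v \<le> restricted_norm t v \<and> restricted_norm s v \<le> restricted_norm t v"
    if "r \<in> adm" "s \<in> adm" for r s
    using refinement[OF that] that monotonicity unfolding restricted_norm_def by blast
  ultimately show ?thesis
    using directed_seminorms_dominate[OF V norm_on_imp_seminorm_on[OF n] restricted_norm_seminorm
        adm_nonempty _ restricted_norm_exceeds_fraction[OF n _ _ \<theta>] _ B(2)]
    by blast
qed

text \<open>
  Stability is available only for elements of the trial space, not for the error \<open>v - w'\<close> itself.
  Hence the detour over an approximation \<open>w\<close> of \<open>v\<close>: the computed \<open>w'\<close> is compared with \<open>w\<close>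
  through stability, and \<open>w\<close> with \<open>v\<close> in the full norm.
\<close>

lemma quasi_optimal_error_bound:
  assumes V: "subspace V" and n: "norm_on V normV" and r: "r \<in> adm"
    and v: "v \<in> V" "w \<in> V" "w' \<in> V" and "0 \<le> S"
    and stable: "normV (w - w') \<le> S * restricted_norm r (w - w')"
    and quasi_optimal: "restricted_norm r (v - w') \<le> C * restricted_norm r (v - w)"
    and C: "0 \<le> C"
  shows "normV (v - w') \<le> (1 + S * (C + 1)) * normV (v - w)"
proof -
  note ns = norm_on_imp_seminorm_on[OF n] and rs = restricted_norm_seminorm[OF r]
  have diff: "v - w \<in> V" "v - w' \<in> V" "w - w' \<in> V"
    using v V by (auto intro: subspace_diff)
  have "restricted_norm r (w - w') \<le> restricted_norm r (v - w') + restricted_norm r (w - v)"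
    using seminorm_on_triangle_sub[OF rs V diff(3,2)] by simp
  also have "restricted_norm r (w - v) = restricted_norm r (v - w)"
    using seminorm_on_minus_commute[OF rs V] v by simp
  also have "restricted_norm r (v - w') + restricted_norm r (v - w)
      \<le> (C + 1) * restricted_norm r (v - w)"
    using quasi_optimal by (simp add: algebra_simps)
  also have "\<dots> \<le> (C + 1) * normV (v - w)"
    using restricted_norm_le[OF n r diff(1)] C by (intro mult_left_mono) auto
  finally have "S * restricted_norm r (w - w') \<le> S * ((C + 1) * normV (v - w))"
    using \<open>0 \<le> S\<close> by (rule mult_left_mono)
  moreover have "normV (v - w') \<le> normV (v - w) + normV (w - w')"
    using seminorm_on_triangle[OF ns diff(1,3)] by simp
  ultimately show ?thesis
    using stable by (simp add: algebra_simps)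
qed

end

section \<open>Trial spaces and the data map\<close>

lemma (in analytic_problem) linear_data_map: "linear (data_map \<Lambda>)"
  using functionals_linear
  by (intro linearI)
    (auto simp: data_map_def fun_eq_iff scaleR_fun_def linear_add linear_scale)

lemma finite_dim_subspace_linear_image:
  assumes "linear f" "finite_dim_subspace W"
  shows "finite_dim_subspace (f ` W)"
  using assms linear_span_image[OF assms(1)] unfolding finite_dim_subspace_def by blast

lemma is_arg_min_imp_INF_eq:
  fixes f :: "'a \<Rightarrow> real"
  assumes "is_arg_min f (\<lambda>x. x \<in> A) a"
  shows "(INF x\<in>A. f x) = f a"
  using assms unfolding is_arg_min_linorder by (intro cInf_eq_minimum) auto

theorem corollary8p4:
  fixes \<Lambda> :: "('u::real_normed_vector \<Rightarrow> real) set"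
    and V :: "'u data set"
    and normV :: "'u data \<Rightarrow> real"
    and adm :: "('u data, 'w::real_vector) restriction set"
    and refines :: "('u data, 'w) restriction \<Rightarrow> ('u data, 'w) restriction \<Rightarrow> bool"
    and v_star :: "'u data"
  assumes "analytic_problem \<Lambda> V normV"
    and "MRD_discretization V normV adm refines"
    and "v_star \<in> V"
  shows "\<forall>U\<^sub>M. finite_dim_subspace U\<^sub>M \<longrightarrow>
    (\<exists>r\<in>adm.
      (\<forall>u\<in>U\<^sub>M. data_seminorm \<Lambda> normV u \<le> 2 * res_norm r (res_map r (data_map \<Lambda> u))) \<and>
      (\<forall>(C\<^sub>A::real) u_star u_tilde.
        1 \<le> C\<^sub>A \<longrightarrow>
        is_arg_min (\<lambda>u. normV (v_star - data_map \<Lambda> u)) (\<lambda>u. u \<in> U\<^sub>M) u_star \<longrightarrow>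
        u_tilde \<in> U\<^sub>M \<longrightarrow>
        res_norm r (res_map r v_star - res_map r (data_map \<Lambda> u_tilde))
          \<le> C\<^sub>A * res_norm r (res_map r v_star - res_map r (data_map \<Lambda> u_star)) \<longrightarrow>
        normV (v_star - data_map \<Lambda> u_tilde)
          \<le> (2 * C\<^sub>A + 3) * (INF u\<in>U\<^sub>M. normV (v_star - data_map \<Lambda> u))))"
proof (intro allI impI)
  fix U\<^sub>M :: "'u set"
  assume U: "finite_dim_subspace U\<^sub>M"
  interpret analytic_problem \<Lambda> V normV by fact
  interpret MRD_discretization V normV adm refines by fact
  let ?D = "data_map \<Lambda>"
  note D_diff = linear_diff[OF linear_data_map]
  have D_in_V: "?D u \<in> V" for u
    using data_map_in_V by auto
  obtain r where r: "r \<in> adm" and stable: "\<And>w. w \<in> ?D ` U\<^sub>M \<Longrightarrow> (1/2) * normV w \<le> restricted_norm r w"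
    using stable_restriction_exists[OF V_subspace V_norm
        finite_dim_subspace_linear_image[OF linear_data_map U], of "1/2"] D_in_V
    by auto
  have U_subspace: "subspace U\<^sub>M"
    using U by (auto simp: finite_dim_subspace_def)
  have stable_D: "normV (?D u) \<le> 2 * restricted_norm r (?D u)" if "u \<in> U\<^sub>M" for u
    using stable[of "?D u"] that by simp
  have "normV (v_star - ?D u_tilde) \<le> (2 * C + 3) * (INF u\<in>U\<^sub>M. normV (v_star - ?D u))"
    if "1 \<le> C" and best: "is_arg_min (\<lambda>u. normV (v_star - ?D u)) (\<lambda>u. u \<in> U\<^sub>M) u_star"
      and "u_tilde \<in> U\<^sub>M"
      and quasi_optimal: "res_norm r (res_map r v_star - res_map r (?D u_tilde))
          \<le> C * res_norm r (res_map r v_star - res_map r (?D u_star))"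
    for C u_star u_tilde
  proof -
    have "u_star - u_tilde \<in> U\<^sub>M"
      using best that(3) by (auto simp: is_arg_min_def intro: subspace_diff[OF U_subspace])
    then have "normV (?D u_star - ?D u_tilde) \<le> 2 * restricted_norm r (?D u_star - ?D u_tilde)"
      using stable_D by (simp flip: D_diff)
    moreover have "restricted_norm r (v_star - ?D u_tilde) \<le> C * restricted_norm r (v_star - ?D u_star)"
      using quasi_optimal assms(3) D_in_V r
      by (simp add: restricted_norm_def res_map_diff[OF V_subspace])
    ultimately have "normV (v_star - ?D u_tilde) \<le> (1 + 2 * (C + 1)) * normV (v_star - ?D u_star)"
      using \<open>1 \<le> C\<close> assms(3) D_in_V r
      by (intro quasi_optimal_error_bound[OF V_subspace V_norm]) auto
    then show ?thesis
      by (simp add: is_arg_min_imp_INF_eq[OF best] algebra_simps)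
  qed
  then show "\<exists>r\<in>adm.
      (\<forall>u\<in>U\<^sub>M. data_seminorm \<Lambda> normV u \<le> 2 * res_norm r (res_map r (?D u))) \<and>
      (\<forall>(C\<^sub>A::real) u_star u_tilde.
        1 \<le> C\<^sub>A \<longrightarrow>
        is_arg_min (\<lambda>u. normV (v_star - ?D u)) (\<lambda>u. u \<in> U\<^sub>M) u_star \<longrightarrow>
        u_tilde \<in> U\<^sub>M \<longrightarrow>
        res_norm r (res_map r v_star - res_map r (?D u_tilde))
          \<le> C\<^sub>A * res_norm r (res_map r v_star - res_map r (?D u_star)) \<longrightarrow>
        normV (v_star - ?D u_tilde) \<le> (2 * C\<^sub>A + 3) * (INF u\<in>U\<^sub>M. normV (v_star - ?D u)))"
    using r stable_D unfolding data_seminorm_def restricted_norm_def by blast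
qed

end
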